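(* Let $\lambda>0$, let $\psi:\mathbb{R}\to\mathbb{R}$ be a convex function, and let $z$, $H$, $\Phi$, $\mathcal{C}$ be the data and operators described in the context. Consider the minimization problem $$(\mathsf{P}_{\lambda,\psi}):\quad \min_{\alpha\in\mathbb{R}^L} J(\alpha),\qquad J(\alpha)=F(H\Phi\alpha)+\imath_{\mathcal{C}}(\Phi\alpha)+\lambda\sum_{i=1}^{L}\psi(\alpha_i),$$ where $$F(\eta)=\sum_{i=1}^n \frac12\left(z_i-2\sqrt{\eta_i+\tfrac38}\right)^2 .$$ Assume that $J$ is coercive (it is convex). Then: 1. (Existence) $(\mathsf{P}_{\lambda,\psi})$ has at least one solution, i.e. the set $\mathcal{M}$ of minimizers of $J$ is nonempty. 2. (Uniqueness) $(\mathsf{P}_{\lambda,\psi})$ has a unique solution if $\Phi$ is a basis and $\ker(H)=\{0\}$, or if $\psi$ is strictly convex.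
   Context: Images of size $\sqrt n\times\sqrt n$ are identified with vectors of $\mathbb{R}^n$. $h$ is a point spread function, i.e. a $\sqrt n\times\sqrt n$ array with nonnegative entries, and $H:\mathbb{R}^n\to\mathbb{R}^n$ is the linear operator $Hx=h\circledast x$ of (two-dimensional) circular convolution with $h$. In particular $H$ maps vectors with nonnegative entries to vectors with nonnegative entries. The observation $y=(y_i)_{1\le i\le n}$ is a vector of nonnegative integers (counts), and $z_i=2\sqrt{y_i+3/8}$ for $1\le i\le n$. The dictionary $\Phi$ is a real $n\times L$ matrix, $L\ge n$, whose columns have unit $\ell_2$-norm and which is either an orthonormal basis of $\mathbb{R}^n$ or a tight frame, i.e. $\Phi\Phi^{\mathrm T}=A\,\mathbf{I}$ for some constant $A>0$ (with $A=1$ for an orthonormal basis). "$\Phi$ is a basis" means that its columns form a basis of $\mathbb{R}^n$. $\mathcal{C}=\{x\in\mathbb{R}^n: x_i\ge 0 \text{ for all } i\}$ is the positive orthant, and $\imath_{\mathcal{C}}$ is its indicator function, equal to $0$ on $\mathcal{C}$ and $+\infty$ outside. Accordingly, $J(\alpha)=+\infty$ whenever $\Phi\alpha\notin\mathcal{C}$; when $\Phi\alpha\in\mathcal{C}$ one has $(H\Phi\alpha)_i\ge 0$ for all $i$, so $F(H\Phi\alpha)$ is well defined. A function $J$ is coercive if $J(\alpha)\to+\infty$ as $\|\alpha\|_2\to+\infty$. *)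

theory Defs
  imports "HOL-Analysis.Analysis"
begin

definition grid :: "nat \<Rightarrow> (nat \<times> nat) set" where
  "grid m = {..<m} \<times> {..<m}"

text \<open>
  Indices of \<open>m \<times> m\<close> images are taken in \<open>{..<m}\<close>; since \<open>k < m\<close>, the natural number
  \<open>(i + m - k) mod m\<close> is the residue of \<open>i - k\<close> modulo \<open>m\<close>.
\<close>

definition circ_conv ::
  "nat \<Rightarrow> (nat \<times> nat \<Rightarrow> real) \<Rightarrow> (nat \<times> nat \<Rightarrow> real) \<Rightarrow> (nat \<times> nat \<Rightarrow> real)" where
  "circ_conv m h u = (\<lambda>(i, j). \<Sum>(k, l)\<in>grid m. h (k, l) * u ((i + m - k) mod m, (j + m - l) mod m))"

text \<open>
  The identification of \<open>m \<times> m\<close> images with vectors is a bijection \<open>idx\<close> from \<open>grid m\<close> onto the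
  coordinate type \<open>'n\<close> (hence \<open>CARD('n) = m * m\<close>); any ordering of the pixels is allowed.
\<close>

definition image_of_vec :: "(nat \<times> nat \<Rightarrow> 'n) \<Rightarrow> real ^ 'n \<Rightarrow> (nat \<times> nat \<Rightarrow> real)" where
  "image_of_vec idx x = (\<lambda>p. x $ idx p)"

definition vec_of_image ::
  "nat \<Rightarrow> (nat \<times> nat \<Rightarrow> 'n) \<Rightarrow> (nat \<times> nat \<Rightarrow> real) \<Rightarrow> real ^ 'n" where
  "vec_of_image m idx u = (\<chi> i. u (inv_into (grid m) idx i))"

definition blur ::
  "nat \<Rightarrow> (nat \<times> nat \<Rightarrow> 'n) \<Rightarrow> (nat \<times> nat \<Rightarrow> real) \<Rightarrow> real ^ 'n \<Rightarrow> real ^ 'n" where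
  "blur m idx h x = vec_of_image m idx (circ_conv m h (image_of_vec idx x))"

text \<open>\<open>columns\<close> is a set, so repeated columns have to be excluded separately.\<close>

definition columns_basis :: "real ^ 'l ^ 'n \<Rightarrow> bool" where
  "columns_basis \<Phi> \<longleftrightarrow>
     inj (\<lambda>j. column j \<Phi>) \<and> independent (columns \<Phi>) \<and> span (columns \<Phi>) = UNIV"

definition orthonormal_basis :: "real ^ 'l ^ 'n \<Rightarrow> bool" where
  "orthonormal_basis \<Phi> \<longleftrightarrow> columns_basis \<Phi> \<and>
     (\<forall>j. norm (column j \<Phi>) = 1) \<and> (\<forall>j k. j \<noteq> k \<longrightarrow> column j \<Phi> \<bullet> column k \<Phi> = 0)"

definition tight_frame :: "real ^ 'l ^ 'n \<Rightarrow> bool" where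
  "tight_frame \<Phi> \<longleftrightarrow> (\<exists>A>0. \<Phi> ** transpose \<Phi> = mat A)"

definition orthant :: "(real ^ 'n) set" where
  "orthant = {x. \<forall>i. 0 \<le> x $ i}"

definition indicator_fn :: "'a set \<Rightarrow> 'a \<Rightarrow> ereal" where
  "indicator_fn S x = (if x \<in> S then 0 else \<infinity>)"

definition anscombe :: "nat ^ 'n \<Rightarrow> real ^ 'n" where
  "anscombe y = (\<chi> i. 2 * sqrt (real (y $ i) + 3 / 8))"

definition fidelity :: "real ^ 'n \<Rightarrow> real ^ 'n \<Rightarrow> real" where
  "fidelity z \<eta> = (\<Sum>i\<in>UNIV. 1 / 2 * (z $ i - 2 * sqrt (\<eta> $ i + 3 / 8))\<^sup>2)"

text \<open>
  The real \<open>sqrt\<close> is total, so \<open>fidelity\<close> is finite everywhere; the indicator term makes the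
  value \<open>\<infinity>\<close> whenever \<open>\<Phi> *v \<alpha>\<close> is outside the orthant.
\<close>

definition objective ::
  "real ^ 'n \<Rightarrow> (real ^ 'n \<Rightarrow> real ^ 'n) \<Rightarrow> real ^ 'l ^ 'n \<Rightarrow> real \<Rightarrow> (real \<Rightarrow> real)
     \<Rightarrow> real ^ 'l \<Rightarrow> ereal" where
  "objective z H \<Phi> lam \<psi> \<alpha> =
     ereal (fidelity z (H (\<Phi> *v \<alpha>))) + indicator_fn orthant (\<Phi> *v \<alpha>)
       + ereal (lam * (\<Sum>i\<in>UNIV. \<psi> (\<alpha> $ i)))"

definition coercive :: "('a::real_normed_vector \<Rightarrow> ereal) \<Rightarrow> bool" where
  "coercive J \<longleftrightarrow> (J \<longlongrightarrow> \<infinity>) at_infinity"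

definition minimizers :: "('a \<Rightarrow> ereal) \<Rightarrow> 'a set" where
  "minimizers J = {\<alpha>. \<forall>\<beta>. J \<alpha> \<le> J \<beta>}"

definition strictly_convex :: "(real \<Rightarrow> real) \<Rightarrow> bool" where
  "strictly_convex f \<longleftrightarrow>
     (\<forall>x y t. x \<noteq> y \<and> 0 < t \<and> t < 1 \<longrightarrow>
        f ((1 - t) * x + t * y) < (1 - t) * f x + t * f y)"

end

theory Submission
  imports Defs
begin

text \<open>
  The feasible coefficient vectors form a closed convex set containing \<open>0\<close>, and on it the objective
  is a finite continuous function \<open>G\<close>. Coercivity confines every competitor of \<open>0\<close> to a closed
  ball, so the extreme value theorem yields a minimizer (\<open>coercive_attains_minimum\<close>).

  For uniqueness it is enough to compare two minimizers with their midpoint: if \<open>G\<close> is strictly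
  smaller at the midpoint of any two distinct feasible points than on average at these points, two
  distinct minimizers are impossible (\<open>minimizer_unique_if_strict_midpoint\<close>). Completing the square
  in the fidelity term shows where its strictness comes from:
  \<open>1/2 * (z - 2 * sqrt (t + 3/8))\<^sup>2 = z\<^sup>2 / 2 + 2 * t + 3/4 - 2 * z * sqrt (t + 3/8)\<close> for \<open>t \<ge> 0\<close>,
  an affine function of \<open>t\<close> minus a positive multiple of a strictly concave one; the Anscombe
  transform of a count is always positive, and the blur of a nonnegative image is nonnegative, so
  \<open>t \<ge> 0\<close> on feasible points. Hence the fidelity is strictly convex in the blurred image. This
  strictness is passed on to the coefficients when both the dictionary and the blur are injective,
  and then a convex penalty suffices; otherwise a strictly convex penalty provides it directly, on
  top of a fidelity that is still convex in the coefficients.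
\<close>

text \<open>
  The ball is chosen so that \<open>J > J x0\<close> outside of it; a minimum over the compact part of \<open>S\<close> in
  the ball is then global, as it is compared with \<open>x0\<close> as well.
\<close>

lemma coercive_attains_minimum:
  fixes G :: "'a::euclidean_space \<Rightarrow> real" and J :: "'a \<Rightarrow> ereal"
  assumes J: "\<And>x. J x = (if x \<in> S then ereal (G x) else \<infinity>)"
    and S: "closed S" "x0 \<in> S"
    and G: "continuous_on S G"
    and coercive: "coercive J"
  shows "minimizers J \<noteq> {}"
proof -
  have "eventually (\<lambda>x. J x0 < J x) at_infinity"
    using coercive S(2) unfolding coercive_def by (elim order_tendstoD) (simp add: J)
  then obtain b where b: "\<And>x. b \<le> norm x \<Longrightarrow> J x0 < J x"
    by (auto simp: eventually_at_infinity)
  let ?K = "S \<inter> cball 0 b"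
  have outside: "J x0 < J x" if "x \<notin> cball 0 b" for x
    using that by (intro b) auto
  then have "x0 \<in> ?K"
    using S(2) by blast
  then obtain x where x: "x \<in> ?K" and min: "\<And>w. w \<in> ?K \<Longrightarrow> G x \<le> G w"
    using continuous_attains_inf[of ?K G] closed_Int_compact[OF S(1) compact_cball]
      continuous_on_subset[OF G, of ?K] by blast
  have "J x \<le> J w" for w
  proof (cases "w \<in> cball 0 b")
    case True
    then show ?thesis using x min[of w] by (auto simp: J)
  next
    case False
    have "J x \<le> J x0"
      using x min[OF \<open>x0 \<in> ?K\<close>] S(2) by (auto simp: J)
    then show ?thesis using outside[OF False] by auto
  qed
  then show ?thesis by (auto simp: minimizers_def)
qed

lemma minimizer_unique_if_strict_midpoint:
  fixes G :: "'a::real_vector \<Rightarrow> real" and J :: "'a \<Rightarrow> ereal"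
  assumes J: "\<And>x. J x = (if x \<in> S then ereal (G x) else \<infinity>)"
    and "convex S" "S \<noteq> {}"
    and strict: "\<And>a b. a \<in> S \<Longrightarrow> b \<in> S \<Longrightarrow> a \<noteq> b \<Longrightarrow> G ((1/2) *\<^sub>R (a + b)) < (G a + G b) / 2"
    and min: "a \<in> minimizers J" "b \<in> minimizers J"
  shows "a = b"
proof (rule ccontr)
  assume "a \<noteq> b"
  obtain s where "s \<in> S" using \<open>S \<noteq> {}\<close> by blast
  have S: "a \<in> S" "b \<in> S"
    using min \<open>s \<in> S\<close> unfolding minimizers_def by (auto simp: J split: if_splits dest!: spec[of _ s])
  let ?c = "(1/2) *\<^sub>R (a + b)"
  have c: "?c \<in> S"
    using convexD[OF \<open>convex S\<close> S, of "1/2" "1/2"] by (simp add: scaleR_add_right)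
  have "J a \<le> J ?c" "J b \<le> J ?c"
    using min by (auto simp: minimizers_def)
  then have "G a \<le> G ?c" "G b \<le> G ?c"
    using S c by (auto simp: J)
  with strict[OF S \<open>a \<noteq> b\<close>] show False by simp
qed

text \<open>
  The squares of the two sides differ by \<open>(sqrt a - sqrt b)\<^sup>2 / 4\<close>.
\<close>

lemma sqrt_strict_midpoint:
  assumes "0 \<le> a" "0 \<le> b" "a \<noteq> b"
  shows "(sqrt a + sqrt b) / 2 < sqrt ((a + b) / 2)"
proof (rule real_less_rsqrt)
  have "0 < (sqrt a - sqrt b)\<^sup>2"
    using assms by simp
  then show "((sqrt a + sqrt b) / 2)\<^sup>2 < (a + b) / 2"
    using assms by (simp add: power2_eq_square algebra_simps)
qed

lemma anscombe_misfit_strict_midpoint: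
  fixes z u v :: real
  assumes "0 < z" "0 \<le> u" "0 \<le> v" "u \<noteq> v"
  shows "1/2 * (z - 2 * sqrt ((u + v) / 2 + 3/8))\<^sup>2
    < (1/2 * (z - 2 * sqrt (u + 3/8))\<^sup>2 + 1/2 * (z - 2 * sqrt (v + 3/8))\<^sup>2) / 2"
proof -
  have expand: "1/2 * (z - 2 * sqrt (t + 3/8))\<^sup>2 = z\<^sup>2 / 2 + 2 * t + 3/4 - 2 * (z * sqrt (t + 3/8))"
    if "0 \<le> t" for t
    using that by (simp add: power2_diff power_mult_distrib algebra_simps)
  have "(sqrt (u + 3/8) + sqrt (v + 3/8)) / 2 < sqrt ((u + v) / 2 + 3/8)"
  proof -
    have "(u + 3/8 + (v + 3/8)) / 2 = (u + v) / 2 + 3/8"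
      by simp
    then show ?thesis
      using sqrt_strict_midpoint[of "u + 3/8" "v + 3/8"] assms by (simp only:)
  qed
  then have "z * ((sqrt (u + 3/8) + sqrt (v + 3/8)) / 2) < z * sqrt ((u + v) / 2 + 3/8)"
    using assms(1) by (rule mult_strict_left_mono)
  moreover have "0 \<le> (u + v) / 2"
    using assms by simp
  ultimately show ?thesis
    unfolding expand[OF assms(2)] expand[OF assms(3)] expand[OF \<open>0 \<le> (u + v) / 2\<close>]
    by (simp add: field_simps)
qed

lemma fidelity_midpoint:
  fixes z u v :: "real ^ 'n::finite"
  assumes z: "\<And>i. 0 < z $ i" and uv: "u \<in> orthant" "v \<in> orthant"
  shows fidelity_midpoint_le:
      "fidelity z ((1/2) *\<^sub>R (u + v)) \<le> (fidelity z u + fidelity z v) / 2"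
    and fidelity_midpoint_less:
      "u \<noteq> v \<Longrightarrow> fidelity z ((1/2) *\<^sub>R (u + v)) < (fidelity z u + fidelity z v) / 2"
proof -
  let ?g = "\<lambda>i t. 1/2 * (z $ i - 2 * sqrt (t + 3/8))\<^sup>2"
  have lhs: "fidelity z ((1/2) *\<^sub>R (u + v)) = (\<Sum>i\<in>UNIV. ?g i ((u $ i + v $ i) / 2))"
    by (simp add: fidelity_def)
  have rhs: "(fidelity z u + fidelity z v) / 2 = (\<Sum>i\<in>UNIV. (?g i (u $ i) + ?g i (v $ i)) / 2)"
    by (simp only: fidelity_def sum.distrib flip: sum_divide_distrib)
  have less: "?g i ((u $ i + v $ i) / 2) < (?g i (u $ i) + ?g i (v $ i)) / 2"
    if "u $ i \<noteq> v $ i" for i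
    using anscombe_misfit_strict_midpoint[of "z $ i" "u $ i" "v $ i"] z uv that
    by (simp add: orthant_def)
  have le: "?g i ((u $ i + v $ i) / 2) \<le> (?g i (u $ i) + ?g i (v $ i)) / 2" for i
    using less[of i] by (cases "u $ i = v $ i") auto
  show "fidelity z ((1/2) *\<^sub>R (u + v)) \<le> (fidelity z u + fidelity z v) / 2"
    unfolding lhs rhs by (intro sum_mono le)
  show "fidelity z ((1/2) *\<^sub>R (u + v)) < (fidelity z u + fidelity z v) / 2" if "u \<noteq> v"
  proof -
    from that obtain i where "u $ i \<noteq> v $ i" by (auto simp: vec_eq_iff)
    then show ?thesis
      unfolding lhs rhs by (intro sum_strict_mono_ex1 ballI le bexI[of _ i] less) auto
  qed
qed

lemma anscombe_pos: "0 < anscombe y $ i"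
  by (simp add: anscombe_def)

lemma linear_blur: "linear (blur m idx h)"
  by (rule linearI)
    (simp_all add: blur_def vec_of_image_def circ_conv_def image_of_vec_def vec_eq_iff
      case_prod_beta sum.distrib sum_distrib_left distrib_left mult.left_commute)

lemma blur_orthant:
  assumes "\<forall>p\<in>grid m. 0 \<le> h p" "x \<in> orthant"
  shows "blur m idx h x \<in> orthant"
  using assms
  by (auto simp: blur_def vec_of_image_def circ_conv_def image_of_vec_def orthant_def
      case_prod_beta intro!: sum_nonneg mult_nonneg_nonneg)

text \<open>
  Distinctness of the columns matters here: it turns a relation between the columns, indexed by
  coordinates, into one over the independent set that they form.
\<close>

lemma columns_basis_imp_inj:
  fixes \<Phi> :: "real ^ 'l::finite ^ 'n::finite"
  assumes "columns_basis \<Phi>"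
  shows "inj ((*v) \<Phi>)"
proof -
  from assms have inj: "inj (\<lambda>j. column j \<Phi>)" and ind: "independent (range (\<lambda>j. column j \<Phi>))"
    by (auto simp: columns_basis_def columns_def full_SetCompr_eq)
  have inv: "inv (\<lambda>j. column j \<Phi>) (column i \<Phi>) = i" for i
    by (rule inv_f_f[OF inj])
  have "x = 0" if "\<Phi> *v x = 0" for x
  proof -
    let ?c = "\<lambda>w. x $ inv (\<lambda>j. column j \<Phi>) w"
    have "(\<Sum>w\<in>range (\<lambda>j. column j \<Phi>). ?c w *\<^sub>R w) = (\<Sum>j\<in>UNIV. x $ j *\<^sub>R column j \<Phi>)"
      using inj by (simp add: sum.reindex inv)
    also have "\<dots> = 0"
      using that by (simp add: matrix_mult_sum scalar_mult_eq_scaleR)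
    finally have "?c (column j \<Phi>) = 0" for j
      using ind by (intro independentD[OF ind]) auto
    then show ?thesis
      by (simp add: vec_eq_iff inv)
  qed
  then show ?thesis
    using linear_injective_0[OF matrix_vector_mul_linear] by blast
qed

lemma convex_orthant: "convex orthant"
  by (auto simp: convex_def orthant_def)

lemma closed_orthant: "closed orthant"
proof -
  have "orthant = (\<Inter>i. {x :: real ^ 'a. 0 \<le> x $ i})"
    by (auto simp: orthant_def)
  also have "closed \<dots>"
    by (intro closed_INT ballI closed_Collect_le continuous_intros)
  finally show ?thesis .
qed

lemma convex_on_midpoint_le:
  assumes "convex_on UNIV (f :: real \<Rightarrow> real)"
  shows "f ((a + b) / 2) \<le> (f a + f b) / 2"
  using convex_onD[OF assms, of "1/2" a b] by (simp add: field_simps)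

lemma strictly_convex_midpoint_less:
  assumes "strictly_convex f" "a \<noteq> b"
  shows "f ((a + b) / 2) < (f a + f b) / 2"
proof -
  have "f ((1 - 1/2) * a + 1/2 * b) < (1 - 1/2) * f a + 1/2 * f b"
    using assms unfolding strictly_convex_def
    by (elim allE[where x = a] allE[where x = b] allE[where x = "1/2"]) auto
  then show ?thesis by (simp add: add_divide_distrib)
qed

theorem proposition2:
  fixes m :: nat
    and idx :: "nat \<times> nat \<Rightarrow> 'n::finite"
    and h :: "nat \<times> nat \<Rightarrow> real"
    and y :: "nat ^ 'n"
    and \<Phi> :: "real ^ 'l::finite ^ 'n"
    and lam :: real
    and \<psi> :: "real \<Rightarrow> real"
  defines "H \<equiv> blur m idx h"
  defines "J \<equiv> objective (anscombe y) H \<Phi> lam \<psi>"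
  assumes idx: "bij_betw idx (grid m) UNIV"
    and psf: "\<forall>p\<in>grid m. 0 \<le> h p"
    and size: "CARD('l) \<ge> CARD('n)"
    and unit_columns: "\<forall>j. norm (column j \<Phi>) = 1"
    and dictionary: "orthonormal_basis \<Phi> \<or> tight_frame \<Phi>"
    and lam: "lam > 0"
    and psi: "convex_on UNIV \<psi>"
    and coercive: "coercive J"
  shows "minimizers J \<noteq> {} \<and>
         ((columns_basis \<Phi> \<and> {x. H x = 0} = {0}) \<or> strictly_convex \<psi>
            \<longrightarrow> (\<exists>!\<alpha>. \<alpha> \<in> minimizers J))"
proof -
  define S where "S = (*v) \<Phi> -` orthant"
  define P where "P \<alpha> = (\<Sum>i\<in>UNIV. \<psi> (\<alpha> $ i))" for \<alpha> :: "real ^ 'l"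
  define G where "G \<alpha> = fidelity (anscombe y) (H (\<Phi> *v \<alpha>)) + lam * P \<alpha>" for \<alpha>
  have H: "linear H"
    unfolding H_def by (rule linear_blur)
  have J: "J \<alpha> = (if \<alpha> \<in> S then ereal (G \<alpha>) else \<infinity>)" for \<alpha>
    by (simp add: J_def objective_def indicator_fn_def S_def G_def P_def)
  have "closed S"
    unfolding S_def by (intro closed_vimage closed_orthant matrix_vector_mult_linear_continuous_on)
  have "convex S"
    unfolding S_def by (intro convex_linear_vimage convex_orthant matrix_vector_mul_linear)
  have "0 \<in> S"
    by (simp add: S_def orthant_def)
  have "continuous_on UNIV (\<lambda>\<alpha>. H (\<Phi> *v \<alpha>))"
    using linear_continuous_on[OF linear_compose[OF matrix_vector_mul_linear H, unfolded o_def
          linear_conv_bounded_linear]] .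
  moreover have psi_cont: "continuous_on UNIV \<psi>"
    by (rule convex_on_continuous[OF open_UNIV psi])
  then have "continuous_on UNIV (\<lambda>\<alpha> :: real ^ 'l. \<psi> (\<alpha> $ i))" for i
    by (rule continuous_on_compose2) (auto intro!: continuous_intros)
  ultimately have "continuous_on UNIV G"
    unfolding G_def P_def fidelity_def by (intro continuous_intros)
  then have "continuous_on S G"
    by (rule continuous_on_subset) simp
  have exist: "minimizers J \<noteq> {}"
    by (rule coercive_attains_minimum[OF J \<open>closed S\<close> \<open>0 \<in> S\<close> \<open>continuous_on S G\<close> coercive])
  have unique: "a = b" if cases: "(columns_basis \<Phi> \<and> {x. H x = 0} = {0}) \<or> strictly_convex \<psi>"
    and min: "a \<in> minimizers J" "b \<in> minimizers J" for a b
  proof (rule minimizer_unique_if_strict_midpoint[OF J \<open>convex S\<close> _ _ min])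
    show "S \<noteq> {}" using \<open>0 \<in> S\<close> by blast
    fix a b assume "a \<in> S" "b \<in> S" "a \<noteq> b"
    let ?c = "(1/2) *\<^sub>R (a + b)"
    let ?F = "fidelity (anscombe y)"
    define u v where "u = H (\<Phi> *v a)" and "v = H (\<Phi> *v b)"
    have uv: "u \<in> orthant" "v \<in> orthant"
      using \<open>a \<in> S\<close> \<open>b \<in> S\<close> blur_orthant[OF psf] by (auto simp: u_def v_def S_def H_def)
    have mid: "H (\<Phi> *v ?c) = (1/2) *\<^sub>R (u + v)"
      by (simp add: u_def v_def linear_cmul[OF H] linear_add[OF H] matrix_vector_right_distrib
          linear_cmul[OF matrix_vector_mul_linear] del: scaleR_add_right)
    have P_avg: "(P a + P b) / 2 = (\<Sum>i\<in>UNIV. (\<psi> (a $ i) + \<psi> (b $ i)) / 2)"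
      by (simp only: P_def sum.distrib flip: sum_divide_distrib)
    have P_mid: "P ?c = (\<Sum>i\<in>UNIV. \<psi> ((a $ i + b $ i) / 2))"
      by (simp add: P_def)
    have P_le: "P ?c \<le> (P a + P b) / 2"
      unfolding P_avg P_mid by (intro sum_mono convex_on_midpoint_le psi)
    have F_le: "?F (H (\<Phi> *v ?c)) \<le> (?F u + ?F v) / 2"
      unfolding mid by (intro fidelity_midpoint_le anscombe_pos uv)
    have "?F (H (\<Phi> *v ?c)) < (?F u + ?F v) / 2 \<or> P ?c < (P a + P b) / 2"
      using cases
    proof
      assume "columns_basis \<Phi> \<and> {x. H x = 0} = {0}"
      then have "inj ((*v) \<Phi>)" "inj H"
        using columns_basis_imp_inj linear_injective_0[OF H] by auto
      then have "u \<noteq> v"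
        using \<open>a \<noteq> b\<close> by (auto simp: u_def v_def dest!: injD)
      then show ?thesis
        unfolding mid by (intro disjI1 fidelity_midpoint_less anscombe_pos uv)
    next
      assume sc: "strictly_convex \<psi>"
      obtain i where i: "a $ i \<noteq> b $ i"
        using \<open>a \<noteq> b\<close> by (auto simp: vec_eq_iff)
      have "P ?c < (P a + P b) / 2"
        unfolding P_avg P_mid
        by (intro sum_strict_mono_ex1 ballI bexI[of _ i] convex_on_midpoint_le psi
            strictly_convex_midpoint_less[OF sc i]) auto
      then show ?thesis ..
    qed
    then have "?F (H (\<Phi> *v ?c)) + lam * P ?c < (?F u + ?F v) / 2 + lam * ((P a + P b) / 2)"
      using F_le P_le lam
      by (elim disjE) (auto intro: add_less_le_mono add_le_less_mono mult_left_mono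
          mult_strict_left_mono simp del: times_divide_eq_right)
    then show "G ?c < (G a + G b) / 2"
      by (simp add: G_def u_def v_def field_simps)
  qed
  from exist unique show ?thesis by blast
qed

end
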